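(* Let $R=K[x_1,\dots,x_n]$ be a polynomial ring over a field $K$, let $\lambda=(\lambda_1,\dots,\lambda_n)\in P_n$ be a partition and set $\lambda_0=0$. The principal Borel symmetric strongly shifted ideal $\mathrm{Sss}(\{\lambda\})$ decomposes as $$\mathrm{Sss}(\{\lambda\})=\prod_{i=1}^nI_{n,i}^{\lambda_i-\lambda_{i-1}}.$$
   Context: $\mathfrak S_n$ acts on $R$ by permuting variables. $P_n=\{\lambda\in\mathbb Z^n: 0\le\lambda_1\le\cdots\le\lambda_n\}$, $x^\lambda=x_1^{\lambda_1}\cdots x_n^{\lambda_n}$. For an $\mathfrak S_n$-fixed monomial ideal $I$ put $P(I)=\{\lambda\in P_n: x^\lambda\in I\}$. An $\mathfrak S_n$-fixed monomial ideal $I$ is symmetric strongly shifted if for every $\lambda\in P(I)$ and $1\le i<j\le n$ with $\lambda_i<\lambda_j$ one has $x^\lambda x_i/x_j\in I$. $\mathrm{Sss}(\{\lambda\})$ is the smallest symmetric strongly shifted ideal containing $x^\lambda$. $I_{n,c}=\bigcap_{1\le i_1<\cdots<i_c\le n}(x_{i_1},\dots,x_{i_c})$ is the square-free Veronese ideal, generated by all square-free monomials of degree $n-c+1$. The exponents in the product denote ordinary powers, and the zeroth power of an ideal is $R$. *)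

theory Defs
  imports
    "HOL-Algebra.Ideal_Product"
    "HOL-Combinatorics.Permutations"
    "HOL-Library.Poly_Mapping"
begin

text \<open>
  Polynomials in countably many variables \<open>x\<^sub>0, x\<^sub>1, \<dots>\<close> over a field: finitely supported
  coefficient functions on exponent vectors.  The ring \<open>K[x\<^sub>1, \<dots>, x\<^sub>n]\<close> is carved out as the
  carrier of a ring record, so that \<open>n\<close> is an ordinary natural number.
\<close>

type_synonym 'k mpoly = "(nat \<Rightarrow>\<^sub>0 nat) \<Rightarrow>\<^sub>0 'k"

definition exponents :: "nat \<Rightarrow> (nat \<Rightarrow>\<^sub>0 nat) set" where
  "exponents n = {m. Poly_Mapping.keys m \<subseteq> {1..n}}"

definition poly_ring :: "nat \<Rightarrow> 'k::field mpoly ring" where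
  "poly_ring n = \<lparr>carrier = {p. Poly_Mapping.keys p \<subseteq> exponents n},
     monoid.mult = (*), one = 1, zero = 0, add = (+)\<rparr>"

definition xpow :: "(nat \<Rightarrow>\<^sub>0 nat) \<Rightarrow> 'k::field mpoly" where
  "xpow m = Poly_Mapping.single m 1"

definition xvar :: "nat \<Rightarrow> 'k::field mpoly" where
  "xvar i = xpow (Poly_Mapping.single i 1)"

text \<open>
  An element of \<open>P\<^sub>n\<close> vanishes outside \<open>{1..n}\<close>; in particular its value at 0 is 0, which is
  the convention \<open>\<lambda>\<^sub>0 = 0\<close> (lemma \<open>partitions_lookup_0\<close> below).
\<close>

definition partitions :: "nat \<Rightarrow> (nat \<Rightarrow>\<^sub>0 nat) set" where
  "partitions n = {l \<in> exponents n.
     \<forall>i j. 1 \<le> i \<and> i \<le> j \<and> j \<le> n \<longrightarrow> Poly_Mapping.lookup l i \<le> Poly_Mapping.lookup l j}"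

text \<open>
  The action \<open>x\<^sub>i \<mapsto> x\<^bsub>\<sigma> i\<^esub>\<close>: the coefficient of \<open>x\<^sup>m\<close> in \<open>\<sigma> p\<close> is the coefficient of
  \<open>x\<^bsup>m \<circ> \<sigma>\<^esup>\<close> in \<open>p\<close>.  Note that \<open>map_key\<close> is composition on the right and is meaningful for
  injective functions only.
\<close>

definition perm_poly :: "(nat \<Rightarrow> nat) \<Rightarrow> 'k::field mpoly \<Rightarrow> 'k mpoly" where
  "perm_poly \<sigma> p = Poly_Mapping.map_key (Poly_Mapping.map_key \<sigma>) p"

definition sym_fixed :: "nat \<Rightarrow> 'k::field mpoly set \<Rightarrow> bool" where
  "sym_fixed n I \<longleftrightarrow> (\<forall>\<sigma>. \<sigma> permutes {1..n} \<longrightarrow> perm_poly \<sigma> ` I = I)"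

definition monomial_ideal :: "nat \<Rightarrow> 'k::field mpoly set \<Rightarrow> bool" where
  "monomial_ideal n I \<longleftrightarrow> (\<exists>M \<subseteq> exponents n. I = Idl\<^bsub>poly_ring n\<^esub> (xpow ` M))"

definition partitions_of :: "nat \<Rightarrow> 'k::field mpoly set \<Rightarrow> (nat \<Rightarrow>\<^sub>0 nat) set" where
  "partitions_of n I = {l \<in> partitions n. xpow l \<in> I}"

text \<open>
  In the next definition \<open>l j > 0\<close>, so the subtraction of exponents is not truncated and the
  exponent vector is that of \<open>x\<^sup>l x\<^sub>i / x\<^sub>j\<close>.
\<close>

definition sss_ideal :: "nat \<Rightarrow> 'k::field mpoly set \<Rightarrow> bool" where
  "sss_ideal n I \<longleftrightarrow> monomial_ideal n I \<and> sym_fixed n I \<and>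
     (\<forall>l \<in> partitions_of n I. \<forall>i j.
        1 \<le> i \<and> i < j \<and> j \<le> n \<and> Poly_Mapping.lookup l i < Poly_Mapping.lookup l j \<longrightarrow>
        xpow (l + Poly_Mapping.single i 1 - Poly_Mapping.single j 1) \<in> I)"

text \<open>That this intersection is itself symmetric strongly shifted is lemma \<open>Sss_smallest\<close> below.\<close>

definition Sss :: "nat \<Rightarrow> (nat \<Rightarrow>\<^sub>0 nat) set \<Rightarrow> 'k::field mpoly set" where
  "Sss n L = \<Inter>{I. sss_ideal n I \<and> xpow ` L \<subseteq> I}"

definition veronese :: "nat \<Rightarrow> nat \<Rightarrow> 'k::field mpoly set" where
  "veronese n c = (\<Inter>S \<in> {S. S \<subseteq> {1..n} \<and> card S = c}. Idl\<^bsub>poly_ring n\<^esub> (xvar ` S))"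


subsection \<open>Well-definedness\<close>

lemma partitions_lookup_0: "l \<in> partitions n \<Longrightarrow> Poly_Mapping.lookup l 0 = 0"
  by (auto simp: partitions_def exponents_def in_keys_iff)

lemma exponents_0 [simp]: "0 \<in> exponents n"
  by (simp add: exponents_def)

lemma exponents_add: "a \<in> exponents n \<Longrightarrow> b \<in> exponents n \<Longrightarrow> a + b \<in> exponents n"
  unfolding exponents_def using Poly_Mapping.keys_add[of a b] by blast

lemma poly_ring_simps [simp]:
  "p \<in> carrier (poly_ring n) \<longleftrightarrow> Poly_Mapping.keys p \<subseteq> exponents n"
  "monoid.mult (poly_ring n) = (*)" "one (poly_ring n) = 1"
  "zero (poly_ring n) = 0" "add (poly_ring n) = (+)"
  by (simp_all add: poly_ring_def)

lemma cring_poly_ring: "cring (poly_ring n :: 'a::field mpoly ring)"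
proof (rule cringI)
  show "abelian_group (poly_ring n :: 'a mpoly ring)"
  proof (rule abelian_groupI)
    fix x :: "'a mpoly" assume x: "x \<in> carrier (poly_ring n)"
    have "- x \<in> carrier (poly_ring n)"
      using x by (auto simp: in_keys_iff subset_iff)
    moreover have "- x \<oplus>\<^bsub>poly_ring n\<^esub> x = \<zero>\<^bsub>poly_ring n\<^esub>" by simp
    ultimately show "\<exists>y\<in>carrier (poly_ring n). y \<oplus>\<^bsub>poly_ring n\<^esub> x = \<zero>\<^bsub>poly_ring n\<^esub>" by (rule bexI[rotated])
  next
    fix x y :: "'a mpoly"
    assume "x \<in> carrier (poly_ring n)" "y \<in> carrier (poly_ring n)"
    then show "x \<oplus>\<^bsub>poly_ring n\<^esub> y \<in> carrier (poly_ring n)"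
      using Poly_Mapping.keys_add[of x y] by auto
  qed (simp_all add: algebra_simps)
  show "comm_monoid (poly_ring n :: 'a mpoly ring)"
  proof (rule comm_monoidI)
    fix x y :: "'a mpoly"
    assume "x \<in> carrier (poly_ring n)" "y \<in> carrier (poly_ring n)"
    then show "x \<otimes>\<^bsub>poly_ring n\<^esub> y \<in> carrier (poly_ring n)"
      using keys_mult[of x y] exponents_add by fastforce
  qed (simp_all add: algebra_simps)
qed (simp add: algebra_simps)

lemma xpow_carrier: "m \<in> exponents n \<Longrightarrow> xpow m \<in> carrier (poly_ring n)"
  by (simp add: xpow_def)

lemma xvar_carrier: "i \<in> {1..n} \<Longrightarrow> xvar i \<in> carrier (poly_ring n)"
  by (simp add: xvar_def xpow_def exponents_def)

lemma xpow_add: "xpow (a + b) = xpow a * xpow b"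
  by (simp add: xpow_def mult_single)

lemma ideal_veronese:
  assumes "c \<le> n"
  shows "ideal (veronese n c :: 'k::field mpoly set) (poly_ring n)"
proof -
  interpret cring "poly_ring n :: 'k mpoly ring" by (rule cring_poly_ring)
  have "{1..c} \<subseteq> {1..n} \<and> card {1..c} = c" using assms by auto
  then have ne: "{S. S \<subseteq> {1..n} \<and> card S = c} \<noteq> {}" by blast
  show ?thesis
    unfolding veronese_def
  proof (rule i_Intersect)
    fix I :: "'k mpoly set"
    assume "I \<in> (\<lambda>S. Idl\<^bsub>poly_ring n\<^esub> (xvar ` S)) ` {S. S \<subseteq> {1..n} \<and> card S = c}"
    then show "ideal I (poly_ring n)"
      by (auto intro!: genideal_ideal xvar_carrier simp del: poly_ring_simps)
  qed (use ne in simp)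
qed

lemma lookup_perm_poly:
  assumes "bij \<sigma>"
  shows "Poly_Mapping.lookup (perm_poly \<sigma> p) m =
    Poly_Mapping.lookup p (Poly_Mapping.map_key \<sigma> m)"
    and "inj (Poly_Mapping.map_key \<sigma> :: (nat \<Rightarrow>\<^sub>0 nat) \<Rightarrow> _)"
    and "surj (Poly_Mapping.map_key \<sigma> :: (nat \<Rightarrow>\<^sub>0 nat) \<Rightarrow> _)"
proof -
  have i: "inj \<sigma>" and s: "surj \<sigma>" using assms by (auto simp: bij_def)
  define \<tau> where "\<tau> = Hilbert_Choice.inv \<sigma>"
  have it: "inj \<tau>" using assms by (simp add: \<tau>_def bij_imp_bij_inv bij_is_inj)
  have c: "\<sigma> \<circ> \<tau> = (\<lambda>x. x)" "\<tau> \<circ> \<sigma> = (\<lambda>x. x)"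
    using i s by (auto simp: \<tau>_def surj_f_inv_f fun_eq_iff)
  have 1: "Poly_Mapping.map_key \<tau> (Poly_Mapping.map_key \<sigma> m) = m" for m :: "nat \<Rightarrow>\<^sub>0 nat"
    using map_key_compose[OF it i, of m] c by (simp add: map_key_id)
  have 2: "Poly_Mapping.map_key \<sigma> (Poly_Mapping.map_key \<tau> m) = m" for m :: "nat \<Rightarrow>\<^sub>0 nat"
    using map_key_compose[OF i it, of m] c by (simp add: map_key_id)
  show I: "inj (Poly_Mapping.map_key \<sigma> :: (nat \<Rightarrow>\<^sub>0 nat) \<Rightarrow> _)"
    by (metis 1 injI)
  show "surj (Poly_Mapping.map_key \<sigma> :: (nat \<Rightarrow>\<^sub>0 nat) \<Rightarrow> _)"
    by (metis 2 surjI)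
  show "Poly_Mapping.lookup (perm_poly \<sigma> p) m =
      Poly_Mapping.lookup p (Poly_Mapping.map_key \<sigma> m)"
    by (simp add: perm_poly_def map_key.rep_eq[OF I])
qed

lemma inj_perm_poly: "bij \<sigma> \<Longrightarrow> inj (perm_poly \<sigma>)"
proof (rule injI, rule poly_mapping_eqI)
  fix p q :: "'a mpoly" and m :: "nat \<Rightarrow>\<^sub>0 nat" assume b: "bij \<sigma>" and e: "perm_poly \<sigma> p = perm_poly \<sigma> q"
  obtain m' where "m = Poly_Mapping.map_key \<sigma> m'" using surjD[OF lookup_perm_poly(3)[OF b]] by blast
  then show "Poly_Mapping.lookup p m = Poly_Mapping.lookup q m"
    using lookup_perm_poly(1)[OF b] e by metis
qed

lemma perm_poly_add: "bij \<sigma> \<Longrightarrow> perm_poly \<sigma> (p + q) = perm_poly \<sigma> p + perm_poly \<sigma> q"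
  by (rule poly_mapping_eqI) (simp add: lookup_perm_poly(1) lookup_add)

lemma perm_poly_single:
  assumes "bij \<sigma>"
  shows "perm_poly \<sigma> (Poly_Mapping.single (Poly_Mapping.map_key \<sigma> m) c) =
    Poly_Mapping.single m c"
  using map_key_single[OF lookup_perm_poly(2)[OF assms]] by (simp add: perm_poly_def)

lemma perm_poly_xvar: "bij \<sigma> \<Longrightarrow> perm_poly \<sigma> (xvar i) = xvar (\<sigma> i)"
  using perm_poly_single[of \<sigma> "Poly_Mapping.single (\<sigma> i) 1" 1]
    map_key_single[of \<sigma> i 1] by (simp add: xvar_def xpow_def bij_is_inj)

lemma mpoly_sum_single:
  "p = (\<Sum>m\<in>Poly_Mapping.keys p. Poly_Mapping.single m (Poly_Mapping.lookup p m))"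
  by (rule poly_mapping_eqI)
    (simp add: lookup_sum lookup_single when_def in_keys_iff)

lemma monomial_ideal_iff:
  "monomial_ideal n I \<longleftrightarrow>
     ideal I (poly_ring n) \<and> (\<forall>p\<in>I. \<forall>m\<in>Poly_Mapping.keys p. xpow m \<in> I)"
  (is "?L \<longleftrightarrow> ?R")
proof
  interpret cring "poly_ring n :: 'a mpoly ring" by (rule cring_poly_ring)
  assume ?L
  then obtain M where M: "M \<subseteq> exponents n" and I: "I = Idl\<^bsub>poly_ring n\<^esub> (xpow ` M)"
    by (auto simp: monomial_ideal_def)
  have sub: "(xpow ` M :: 'a mpoly set) \<subseteq> carrier (poly_ring n)"
    using M xpow_carrier by blast
  have id: "ideal I (poly_ring n)" unfolding I by (rule genideal_ideal[OF sub])
  interpret I: ideal I "poly_ring n" by (rule id)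
  define J where "J = {p :: 'a mpoly. Poly_Mapping.keys p \<subseteq> exponents n \<and>
    (\<forall>m\<in>Poly_Mapping.keys p. xpow m \<in> I)}"
  have l: "r * p \<in> J" if p: "p \<in> J" and r: "r \<in> carrier (poly_ring n)" for p r
  proof -
    have "xpow m \<in> I" if m: "m \<in> Poly_Mapping.keys (r * p)" for m
    proof -
      obtain a b where ab: "m = a + b" "a \<in> Poly_Mapping.keys r" "b \<in> Poly_Mapping.keys p"
        using keys_mult[of r p] m by blast
      have "xpow a \<in> carrier (poly_ring n)" using ab r xpow_carrier by auto
      then show ?thesis using I.I_l_closed[of "xpow b" "xpow a"] ab p
        by (simp add: J_def xpow_add)
    qed
    moreover have "r * p \<in> carrier (poly_ring n)"
      using m_closed[of r p] r p by (simp add: J_def)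
    ultimately show ?thesis by (simp add: J_def)
  qed
  have "ideal J (poly_ring n)"
  proof (rule idealI)
    show "ring (poly_ring n :: 'a mpoly ring)" by (rule ring_axioms)
    show "subgroup J (add_monoid (poly_ring n))"
    proof (rule add.subgroupI)
      show "J \<subseteq> carrier (poly_ring n)" by (auto simp: J_def)
      show "J \<noteq> {}" by (auto simp: J_def intro!: exI[of _ 0])
    next
      fix p assume p: "p \<in> J"
      have "\<ominus>\<^bsub>poly_ring n\<^esub> p = - 1 * p"
      proof (rule minus_equality)
        show "- 1 * p \<oplus>\<^bsub>poly_ring n\<^esub> p = \<zero>\<^bsub>poly_ring n\<^esub>" by simp
        show "p \<in> carrier (poly_ring n)" using p by (simp add: J_def)
        show "- 1 * p \<in> carrier (poly_ring n)" using p by (simp add: J_def)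
      qed
      moreover have "- 1 * p \<in> J" using p by (intro l) simp_all
      ultimately show "\<ominus>\<^bsub>poly_ring n\<^esub> p \<in> J" by simp
    next
      fix p q assume "p \<in> J" "q \<in> J"
      then show "p \<oplus>\<^bsub>poly_ring n\<^esub> q \<in> J"
        using Poly_Mapping.keys_add[of p q] by (auto simp: J_def)
    qed
  qed (use l in \<open>auto simp: mult.commute\<close>)
  moreover have "xpow ` M \<subseteq> J"
    using M genideal_self[OF sub] by (auto simp: J_def I xpow_def)
  ultimately have "I \<subseteq> J" unfolding I by (rule genideal_minimal)
  then show ?R using id by (auto simp: J_def)
next
  interpret cring "poly_ring n :: 'a mpoly ring" by (rule cring_poly_ring)
  assume R: ?R
  then interpret I: ideal I "poly_ring n" by simp
  define M where "M = {m \<in> exponents n. (xpow m :: 'a mpoly) \<in> I}"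
  have sub: "(xpow ` M :: 'a mpoly set) \<subseteq> carrier (poly_ring n)"
    using xpow_carrier by (auto simp: M_def simp del: poly_ring_simps)
  interpret G: ideal "Idl\<^bsub>poly_ring n\<^esub> (xpow ` M :: 'a mpoly set)" "poly_ring n"
    by (rule genideal_ideal[OF sub])
  have "I \<subseteq> Idl\<^bsub>poly_ring n\<^esub> (xpow ` M)"
  proof
    fix p assume p: "p \<in> I"
    have s: "Poly_Mapping.single m c \<in> Idl\<^bsub>poly_ring n\<^esub> (xpow ` M)"
      if "m \<in> Poly_Mapping.keys p" for m and c :: 'a
    proof -
      have "m \<in> M" using R p that I.Icarr[OF p] by (auto simp: M_def)
      then have "xpow m \<in> Idl\<^bsub>poly_ring n\<^esub> (xpow ` M :: 'a mpoly set)"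
        using genideal_self[OF sub] by blast
      then have "Poly_Mapping.single 0 c * xpow m \<in> Idl\<^bsub>poly_ring n\<^esub> (xpow ` M)"
        using G.I_l_closed[of "xpow m" "Poly_Mapping.single 0 c"] by simp
      then show ?thesis by (simp add: xpow_def mult_single)
    qed
    have "(\<Sum>m\<in>A. Poly_Mapping.single m (Poly_Mapping.lookup p m)) \<in> Idl\<^bsub>poly_ring n\<^esub> (xpow ` M)"
      if "finite A" "A \<subseteq> Poly_Mapping.keys p" for A
      using that
    proof (induction A rule: finite_induct)
      case empty
      then show ?case using G.zero_closed by simp
    next
      case (insert a A)
      then show ?case using G.a_closed[OF s, of a] by simp
    qed
    from this[OF finite_keys order_refl]
    show "p \<in> Idl\<^bsub>poly_ring n\<^esub> (xpow ` M)" using mpoly_sum_single[of p] by simp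
  qed
  moreover have "Idl\<^bsub>poly_ring n\<^esub> (xpow ` M) \<subseteq> I"
    by (rule genideal_minimal) (use R in \<open>auto simp: M_def\<close>)
  ultimately have "I = Idl\<^bsub>poly_ring n\<^esub> (xpow ` M)" by (rule equalityI)
  moreover have "M \<subseteq> exponents n" by (auto simp: M_def)
  ultimately show ?L unfolding monomial_ideal_def by (intro exI[of _ M] conjI)
qed

lemma perm_poly_carrier:
  assumes "\<sigma> permutes {1..n}" "p \<in> carrier (poly_ring n)"
  shows "perm_poly \<sigma> p \<in> carrier (poly_ring n)"
proof -
  have b: "bij \<sigma>" using assms permutes_bij by blast
  have "m \<in> exponents n" if "m \<in> Poly_Mapping.keys (perm_poly \<sigma> p)" for m
  proof -
    have "Poly_Mapping.map_key \<sigma> m \<in> exponents n"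
      using that assms by (auto simp: in_keys_iff lookup_perm_poly(1)[OF b])
    then have "\<sigma> -` Poly_Mapping.keys m \<subseteq> {1..n}"
      by (simp add: exponents_def keys_map_key bij_is_inj b)
    then have "Poly_Mapping.keys m \<subseteq> \<sigma> ` {1..n}"
      using b by (metis bij_is_surj image_mono surj_image_vimage_eq)
    then show ?thesis using permutes_image[OF assms(1)] by (simp add: exponents_def)
  qed
  then show ?thesis by auto
qed

lemma sss_carrier: "sss_ideal n (carrier (poly_ring n))"
proof -
  interpret cring "poly_ring n :: 'a mpoly ring" by (rule cring_poly_ring)
  have "ideal (carrier (poly_ring n :: 'a mpoly ring)) (poly_ring n)" by (rule oneideal)
  then have "monomial_ideal n (carrier (poly_ring n :: 'a mpoly ring))"
    unfolding monomial_ideal_iff by (auto simp: xpow_def)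
  moreover have "sym_fixed n (carrier (poly_ring n :: 'a mpoly ring))"
    unfolding sym_fixed_def
  proof (intro allI impI equalityI subsetI)
    fix \<sigma> and p :: "'a mpoly" assume s: "\<sigma> permutes {1..n}"
    { assume "p \<in> perm_poly \<sigma> ` carrier (poly_ring n)"
      then show "p \<in> carrier (poly_ring n)" using perm_poly_carrier[OF s] by blast }
    { assume p: "p \<in> carrier (poly_ring n)"
      define \<tau> where "\<tau> = Hilbert_Choice.inv \<sigma>"
      have t: "\<tau> permutes {1..n}" using s by (simp add: \<tau>_def permutes_inv)
      have b: "bij \<sigma>" "bij \<tau>" using s t permutes_bij by blast+
      have "perm_poly \<sigma> (perm_poly \<tau> p) = p"
      proof (rule poly_mapping_eqI)
        fix m :: "nat \<Rightarrow>\<^sub>0 nat"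
        have "Poly_Mapping.map_key \<tau> (Poly_Mapping.map_key \<sigma> m) = m"
          using map_key_compose[of \<tau> \<sigma> m] b permutes_inv_o(1)[OF s]
          by (simp add: \<tau>_def bij_is_inj id_def map_key_id)
        then show "Poly_Mapping.lookup (perm_poly \<sigma> (perm_poly \<tau> p)) m = Poly_Mapping.lookup p m"
          by (simp add: lookup_perm_poly(1) b)
      qed
      then show "p \<in> perm_poly \<sigma> ` carrier (poly_ring n)"
        using perm_poly_carrier[OF t p] by (metis imageI) }
  qed
  moreover have "xpow (l + Poly_Mapping.single i 1 - Poly_Mapping.single j 1)
      \<in> carrier (poly_ring n :: 'a mpoly ring)"
    if l: "l \<in> exponents n" and ij: "1 \<le> i" "i < j" "j \<le> n" for l i j
  proof (rule xpow_carrier)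
    have "k \<in> {1..n}"
      if "k \<in> Poly_Mapping.keys (l + Poly_Mapping.single i 1 - Poly_Mapping.single j 1)" for k
    proof (cases "k = i")
      case True
      then show ?thesis using ij by auto
    next
      case False
      then have "Poly_Mapping.lookup l k \<noteq> 0"
        using that by (auto simp: in_keys_iff lookup_add lookup_minus lookup_single)
      then have "k \<in> Poly_Mapping.keys l" by (simp add: in_keys_iff)
      then show ?thesis using l by (auto simp: exponents_def)
    qed
    then show "l + Poly_Mapping.single i 1 - Poly_Mapping.single j 1 \<in> exponents n"
      unfolding exponents_def by blast
  qed
  ultimately show ?thesis
    by (auto simp: sss_ideal_def partitions_of_def partitions_def simp del: poly_ring_simps)
qed

lemma Sss_smallest:
  assumes "L \<subseteq> partitions n"
  shows "sss_ideal n (Sss n L :: 'k::field mpoly set)"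
    and "xpow ` L \<subseteq> (Sss n L :: 'k mpoly set)"
    and "\<And>I :: 'k mpoly set. sss_ideal n I \<Longrightarrow> xpow ` L \<subseteq> I \<Longrightarrow> Sss n L \<subseteq> I"
proof -
  interpret cring "poly_ring n :: 'k mpoly ring" by (rule cring_poly_ring)
  define F where "F = {I :: 'k mpoly set. sss_ideal n I \<and> xpow ` L \<subseteq> I}"
  have F: "Sss n L = \<Inter>F" by (simp add: Sss_def F_def)
  have "carrier (poly_ring n) \<in> F"
    using assms by (auto simp: F_def partitions_def sss_carrier
        intro!: xpow_carrier simp del: poly_ring_simps)
  then have ne: "F \<noteq> {}" by blast
  have mono: "ideal I (poly_ring n)" "\<forall>p\<in>I. \<forall>m\<in>Poly_Mapping.keys p. xpow m \<in> I" if "I \<in> F" for I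
    using that monomial_ideal_iff by (auto simp: F_def sss_ideal_def)
  have "monomial_ideal n (\<Inter>F)"
    unfolding monomial_ideal_iff using i_Intersect[of F] ne mono by blast
  moreover have "sym_fixed n (\<Inter>F)"
    unfolding sym_fixed_def
  proof (intro allI impI)
    fix \<sigma> assume s: "\<sigma> permutes {1..n}"
    have i: "inj (perm_poly \<sigma> :: 'k mpoly \<Rightarrow> _)" using s permutes_bij inj_perm_poly by blast
    obtain I0 where "I0 \<in> F" using ne by blast
    then have "perm_poly \<sigma> ` \<Inter>F = (\<Inter>I\<in>F. perm_poly \<sigma> ` I)"
      using image_INT[OF i, of F "\<lambda>I. I" I0] by simp
    also have "\<dots> = \<Inter>F"
      using s by (auto simp: F_def sss_ideal_def sym_fixed_def)
    finally show "perm_poly \<sigma> ` \<Inter>F = \<Inter>F" .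
  qed
  ultimately show "sss_ideal n (Sss n L :: 'k mpoly set)"
    unfolding F sss_ideal_def
    by (auto simp: partitions_of_def F_def) (auto simp: sss_ideal_def partitions_of_def)
  show "xpow ` L \<subseteq> (Sss n L :: 'k mpoly set)" by (auto simp: Sss_def)
  show "\<And>I :: 'k mpoly set. sss_ideal n I \<Longrightarrow> xpow ` L \<subseteq> I \<Longrightarrow> Sss n L \<subseteq> I"
    by (auto simp: Sss_def)
qed

end

theory Submission
  imports Defs
begin

text \<open>
  The product is spanned by the monomials \<open>x\<^sup>m\<close> for which \<open>m\<close> dominates a sum of indicator vectors
  of sets \<open>A\<^sub>p\<close>, with \<open>\<lambda>\<^sub>i - \<lambda>\<^bsub>i-1\<^esub>\<close> sets of size \<open>n - i + 1\<close> for every \<open>i\<close>.  If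
  \<open>m\<^sub>i < m\<^sub>j\<close>, then either \<open>m\<^sub>j\<close> exceeds the number of sets containing \<open>j\<close>, or some \<open>A\<^sub>p\<close> contains
  \<open>j\<close> but not \<open>i\<close> and \<open>j\<close> may be exchanged for \<open>i\<close> in it; hence the product is symmetric strongly
  shifted.  Conversely, if some \<open>A\<^sub>p\<close> contains \<open>i\<close> but not \<open>j > i\<close>, then \<open>x\<^sup>m\<close> is obtained by a shift
  from the monomial in which \<open>i\<close> has been exchanged for \<open>j\<close> (when \<open>m\<^sub>i \<le> m\<^sub>j\<close>), or by a transposition
  of variables (when \<open>m\<^sub>i > m\<^sub>j\<close>).  Both steps move weight to the right, so this process ends,
  namely when every \<open>A\<^sub>p\<close> is a final segment of \<open>{1..n}\<close>; then \<open>x\<^sup>m\<close> is a multiple of \<open>x\<^sup>\<lambda>\<close>.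
\<close>

section \<open>Ideals spanned by monomials\<close>

text \<open>The \<open>K\<close>-span of the monomials with exponents in \<open>U\<close>, encoded
  through supports, so that cancellation of terms never leads out of it.\<close>

definition mspan :: "(nat \<Rightarrow>\<^sub>0 nat) set \<Rightarrow> 'k::field mpoly set" where
  "mspan U = {p. Poly_Mapping.keys p \<subseteq> U}"

text \<open>Closure under multiplication by monomials in the \<open>n\<close> variables: these are
  the exponent sets of monomial ideals.\<close>

definition upset :: "nat \<Rightarrow> (nat \<Rightarrow>\<^sub>0 nat) set \<Rightarrow> bool" where
  "upset n U \<longleftrightarrow> U \<subseteq> exponents n \<and> (\<forall>u\<in>U. \<forall>a\<in>exponents n. a + u \<in> U)"

lemma exponents_iff: "m \<in> exponents n \<longleftrightarrow> (\<forall>x. x \<notin> {1..n} \<longrightarrow> Poly_Mapping.lookup m x = 0)"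
  unfolding exponents_def by (auto simp: in_keys_iff subset_iff)

lemma xpow_mem_mspan [simp]: "xpow m \<in> mspan U \<longleftrightarrow> m \<in> U"
  by (simp add: xpow_def mspan_def)

lemma ideal_mspan:
  assumes "upset n U"
  shows "ideal (mspan U :: 'k::field mpoly set) (poly_ring n)"
proof -
  interpret cring "poly_ring n :: 'k mpoly ring" by (rule cring_poly_ring)
  have l: "r * p \<in> mspan U" if p: "p \<in> mspan U" and r: "r \<in> carrier (poly_ring n)" for p r :: "'k mpoly"
    using keys_mult[of r p] p r assms by (fastforce simp: mspan_def upset_def)
  show ?thesis
  proof (rule idealI)
    show "ring (poly_ring n :: 'k mpoly ring)" by (rule ring_axioms)
    show "subgroup (mspan U :: 'k mpoly set) (add_monoid (poly_ring n))"
    proof (rule add.subgroupI)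
      show "mspan U \<subseteq> carrier (poly_ring n :: 'k mpoly ring)"
        using assms by (auto simp: mspan_def upset_def)
      show "(mspan U :: 'k mpoly set) \<noteq> {}" by (auto simp: mspan_def intro!: exI[of _ 0])
    next
      fix p :: "'k mpoly" assume p: "p \<in> mspan U"
      have "\<ominus>\<^bsub>poly_ring n\<^esub> p = - p"
        by (rule minus_equality) (use p assms in \<open>auto simp: mspan_def upset_def\<close>)
      then show "\<ominus>\<^bsub>poly_ring n\<^esub> p \<in> mspan U" using p by (simp add: mspan_def)
    next
      fix p q :: "'k mpoly" assume "p \<in> mspan U" "q \<in> mspan U"
      then show "p \<oplus>\<^bsub>poly_ring n\<^esub> q \<in> mspan U"
        using Poly_Mapping.keys_add[of p q] by (auto simp: mspan_def)
    qed
  qed (use l in \<open>auto simp: mult.commute\<close>)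
qed

text \<open>A polynomial is a finite sum of terms, and a term is a constant times a monomial.
  Inclusions of spans in ideals are thereby reduced to monomials.\<close>

lemma mspan_subset_ideal:
  fixes I :: "'k::field mpoly set"
  assumes "ideal I (poly_ring n)" "\<And>m. m \<in> U \<Longrightarrow> xpow m \<in> I"
  shows "mspan U \<subseteq> I"
proof
  interpret cring "poly_ring n :: 'k mpoly ring" by (rule cring_poly_ring)
  interpret I: ideal I "poly_ring n" by fact
  fix p :: "'k mpoly" assume p: "p \<in> mspan U"
  have s: "Poly_Mapping.single m c \<in> I" if "m \<in> Poly_Mapping.keys p" for m and c :: 'k
  proof -
    have "xpow m \<in> I" using assms(2) that p by (auto simp: mspan_def)
    then have "Poly_Mapping.single 0 c * xpow m \<in> I"
      using I.I_l_closed[of "xpow m" "Poly_Mapping.single 0 c"] by simp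
    then show ?thesis by (simp add: xpow_def mult_single)
  qed
  have "(\<Sum>m\<in>A. Poly_Mapping.single m (Poly_Mapping.lookup p m)) \<in> I"
    if "finite A" "A \<subseteq> Poly_Mapping.keys p" for A
    using that
  proof (induction A rule: finite_induct)
    case empty
    then show ?case using I.zero_closed by simp
  next
    case (insert a A)
    then show ?case using I.a_closed[OF s, of a] by simp
  qed
  from this[OF finite_keys order_refl] show "p \<in> I" using mpoly_sum_single[of p] by simp
qed

text \<open>Exponents of a product of polynomials are sums of exponents of the factors, and x^(u+v)
  is itself one product. Ideal products thus become sumsets.\<close>

lemma ideal_prod_mspan:
  assumes U: "upset n U" and V: "upset n V"
  shows "ideal_prod (poly_ring n) (mspan U) (mspan V :: 'k::field mpoly set) =
    mspan {u + v |u v. u \<in> U \<and> v \<in> V}" (is "_ = mspan ?W")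
proof
  interpret cring "poly_ring n :: 'k mpoly ring" by (rule cring_poly_ring)
  show "ideal_prod (poly_ring n) (mspan U) (mspan V) \<subseteq> (mspan ?W :: 'k mpoly set)"
  proof
    fix s :: "'k mpoly" assume "s \<in> ideal_prod (poly_ring n) (mspan U) (mspan V)"
    then show "s \<in> mspan ?W"
    proof (induction rule: ideal_prod.induct)
      case (prod i j)
      then show ?case using keys_mult[of i j] by (fastforce simp: mspan_def)
    next
      case (sum s1 s2)
      then show ?case using Poly_Mapping.keys_add[of s1 s2] by (auto simp: mspan_def)
    qed
  qed
  have "xpow (u + v) \<in> ideal_prod (poly_ring n) (mspan U) (mspan V :: 'k mpoly set)"
    if "u \<in> U" "v \<in> V" for u v
    using ideal_prod.prod[of "xpow u" "mspan U" "xpow v" "mspan V :: 'k mpoly set" "poly_ring n"] that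
    by (simp add: xpow_add)
  then show "mspan ?W \<subseteq> ideal_prod (poly_ring n) (mspan U) (mspan V :: 'k mpoly set)"
    by (intro mspan_subset_ideal[OF ideal_prod_is_ideal[OF ideal_mspan[OF U] ideal_mspan[OF V]]]) auto
qed

section \<open>Square-free Veronese ideals in terms of supports\<close>

lemma genideal_xvar:
  assumes "S \<subseteq> {1..n}"
  shows "Idl\<^bsub>poly_ring n\<^esub> (xvar ` S :: 'k::field mpoly set) =
    mspan {m \<in> exponents n. Poly_Mapping.keys m \<inter> S \<noteq> {}}" (is "_ = mspan ?U")
proof
  interpret cring "poly_ring n :: 'k mpoly ring" by (rule cring_poly_ring)
  have sub: "(xvar ` S :: 'k mpoly set) \<subseteq> carrier (poly_ring n)"
    using assms xvar_carrier by blast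
  interpret I: ideal "Idl\<^bsub>poly_ring n\<^esub> (xvar ` S :: 'k mpoly set)" "poly_ring n"
    by (rule genideal_ideal[OF sub])
  have up: "upset n ?U"
    unfolding upset_def by (auto simp: exponents_add in_keys_iff lookup_add disjoint_iff)
  have "xvar ` S \<subseteq> (mspan ?U :: 'k mpoly set)"
    using assms by (auto simp: xvar_def exponents_def)
  then show "Idl\<^bsub>poly_ring n\<^esub> (xvar ` S) \<subseteq> (mspan ?U :: 'k mpoly set)"
    by (rule genideal_minimal[OF ideal_mspan[OF up]])
  show "mspan ?U \<subseteq> Idl\<^bsub>poly_ring n\<^esub> (xvar ` S :: 'k mpoly set)"
  proof (rule mspan_subset_ideal[OF I.ideal_axioms])
    fix m assume "m \<in> ?U"
    then obtain i where m: "m \<in> exponents n" and i: "i \<in> S" "Poly_Mapping.lookup m i \<noteq> 0"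
      by (auto simp: in_keys_iff)
    \<comment> \<open>The exponent of x^m / x_i; the subtraction is exact because x_i divides
      x^m.\<close>
    define r where "r = m - Poly_Mapping.single i 1"
    have "m = r + Poly_Mapping.single i 1"
      using i by (intro poly_mapping_eqI) (auto simp: r_def lookup_add lookup_minus lookup_single when_def)
    then have e: "xpow m = xpow r * (xvar i :: 'k mpoly)"
      by (simp add: xpow_add xvar_def)
    have "r \<in> exponents n"
      using m by (auto simp: exponents_iff r_def lookup_minus)
    moreover have "xvar i \<in> Idl\<^bsub>poly_ring n\<^esub> (xvar ` S :: 'k mpoly set)"
      using genideal_self[OF sub] i by blast
    ultimately show "xpow m \<in> Idl\<^bsub>poly_ring n\<^esub> (xvar ` S :: 'k mpoly set)"
      using I.I_l_closed[of "xvar i" "xpow r"] e by (simp add: xpow_def)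
  qed
qed

text \<open>At least n - c + 1 variables occur, that is, some square-free monomial of that degree
  divides x^m. The additive form avoids truncated subtraction.\<close>

definition veronese_exponents :: "nat \<Rightarrow> nat \<Rightarrow> (nat \<Rightarrow>\<^sub>0 nat) set" where
  "veronese_exponents n c = {m \<in> exponents n. n < c + card (Poly_Mapping.keys m)}"

lemma upset_veronese_exponents: "upset n (veronese_exponents n c)"
proof -
  have "card (Poly_Mapping.keys u) \<le> card (Poly_Mapping.keys (a + u))" for a u :: "nat \<Rightarrow>\<^sub>0 nat"
    by (rule card_mono) (auto simp: in_keys_iff lookup_add)
  then show ?thesis
    unfolding upset_def veronese_exponents_def
    by (auto intro: exponents_add less_le_trans)
qed

text \<open>A support meets every \<open>c\<close>-subset of \<open>{1..n}\<close> exactly when its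
  complement is too small to contain one. The bound on \<open>c\<close> supplies a
  \<open>c\<close>-subset; over an empty family the intersection would be the whole type.\<close>

lemma veronese_eq_mspan:
  assumes "c \<le> n"
  shows "(veronese n c :: 'k::field mpoly set) = mspan (veronese_exponents n c)"
proof -
  define F where "F = {S. S \<subseteq> {1..n} \<and> card S = c}"
  have "(\<forall>S\<in>F. m \<in> exponents n \<and> Poly_Mapping.keys m \<inter> S \<noteq> {}) \<longleftrightarrow> m \<in> veronese_exponents n c" for m
  proof
    assume *: "\<forall>S\<in>F. m \<in> exponents n \<and> Poly_Mapping.keys m \<inter> S \<noteq> {}"
    have "{1..c} \<in> F" using assms by (auto simp: F_def)
    with * have m: "Poly_Mapping.keys m \<subseteq> {1..n}" by (auto simp: exponents_def)
    have "\<not> c \<le> card ({1..n} - Poly_Mapping.keys m)"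
    proof
      assume "c \<le> card ({1..n} - Poly_Mapping.keys m)"
      then obtain S where "S \<subseteq> {1..n} - Poly_Mapping.keys m" "card S = c"
        by (rule obtain_subset_with_card_n)
      then have "S \<in> F" "Poly_Mapping.keys m \<inter> S = {}" by (auto simp: F_def)
      then show False using * by blast
    qed
    moreover have "card ({1..n} - Poly_Mapping.keys m) = n - card (Poly_Mapping.keys m)"
      using m by (simp add: card_Diff_subset)
    ultimately show "m \<in> veronese_exponents n c"
      using m by (auto simp: veronese_exponents_def exponents_def)
  next
    assume m: "m \<in> veronese_exponents n c"
    show "\<forall>S\<in>F. m \<in> exponents n \<and> Poly_Mapping.keys m \<inter> S \<noteq> {}"
    proof (intro ballI conjI notI)
      fix S assume S: "S \<in> F" and e: "Poly_Mapping.keys m \<inter> S = {}"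
      have "card (Poly_Mapping.keys m \<union> S) \<le> card {1..n}"
        using S m by (intro card_mono) (auto simp: F_def veronese_exponents_def exponents_def)
      moreover have "finite S" using S by (auto simp: F_def intro: finite_subset)
      ultimately show False
        using S m e by (simp add: card_Un_disjoint F_def veronese_exponents_def)
    qed (use m in \<open>simp add: veronese_exponents_def\<close>)
  qed
  moreover have "(veronese n c :: 'k mpoly set) =
      (\<Inter>S\<in>F. mspan {m \<in> exponents n. Poly_Mapping.keys m \<inter> S \<noteq> {}})"
    unfolding veronese_def F_def by (intro INF_cong) (auto simp: genideal_xvar)
  ultimately show ?thesis by (fastforce simp: mspan_def)
qed

section \<open>Products of Veronese ideals\<close>

text \<open>\<open>P\<close> indexes the factors of a product of Veronese ideals, repetitions
  included; \<open>A p\<close> is the support of a square-free generator of the factor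
  \<open>veronese n (c p)\<close>.\<close>

definition set_family :: "nat \<Rightarrow> 'p set \<Rightarrow> ('p \<Rightarrow> nat) \<Rightarrow> ('p \<Rightarrow> nat set) \<Rightarrow> bool" where
  "set_family n P c A \<longleftrightarrow> (\<forall>p\<in>P. A p \<subseteq> {1..n} \<and> card (A p) = n + 1 - c p)"

text \<open>Divisibility by counting: for finite \<open>P\<close>, the product of the square-free
  monomials with supports \<open>A p\<close> divides x^m.\<close>

definition dominates :: "'p set \<Rightarrow> (nat \<Rightarrow>\<^sub>0 nat) \<Rightarrow> ('p \<Rightarrow> nat set) \<Rightarrow> bool" where
  "dominates P m A \<longleftrightarrow> (\<forall>x. card {p \<in> P. x \<in> A p} \<le> Poly_Mapping.lookup m x)"

definition dominating :: "nat \<Rightarrow> 'p set \<Rightarrow> ('p \<Rightarrow> nat) \<Rightarrow> (nat \<Rightarrow>\<^sub>0 nat) set" where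
  "dominating n P c = {m \<in> exponents n. \<exists>A. set_family n P c A \<and> dominates P m A}"

lemma upset_dominating: "upset n (dominating n P c)"
  unfolding upset_def
proof (intro conjI ballI)
  fix u a assume "u \<in> dominating n P c" "a \<in> exponents n"
  then show "a + u \<in> dominating n P c"
    by (auto simp: dominating_def dominates_def lookup_add intro: exponents_add trans_le_add2)
qed (auto simp: dominating_def)

lemma card_filter_insert:
  assumes "finite P" "q \<notin> P"
  shows "card {p \<in> insert q P. Q p} = (if Q q then 1 else 0) + card {p \<in> P. Q p}"
proof -
  have "{p \<in> insert q P. Q p} = (if Q q then insert q {p \<in> P. Q p} else {p \<in> P. Q p})" by auto
  then show ?thesis using assms by simp
qed

lemma dominating_insert:
  assumes "finite P" "q \<notin> P" "c q \<in> {1..n}"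
  shows "{u + v |u v. u \<in> veronese_exponents n (c q) \<and> v \<in> dominating n P c} =
    dominating n (insert q P) c" (is "?L = ?R")
proof (intro equalityI subsetI)
  fix m assume "m \<in> ?L"
  then obtain u v where m: "m = u + v" and u: "u \<in> veronese_exponents n (c q)"
    and v: "v \<in> dominating n P c" by blast
  obtain A where A: "set_family n P c A" "dominates P v A" using v by (auto simp: dominating_def)
  \<comment> \<open>The support of \<open>u\<close> is shrunk to the prescribed size; domination
    survives because \<open>u\<close> is at least 1 on it.\<close>
  have "n + 1 - c q \<le> card (Poly_Mapping.keys u)" using u by (auto simp: veronese_exponents_def)
  then obtain B where B: "B \<subseteq> Poly_Mapping.keys u" "card B = n + 1 - c q"
    by (rule obtain_subset_with_card_n)
  define A' where "A' = A(q := B)"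
  have A': "p \<in> P \<Longrightarrow> A' p = A p" "A' q = B" for p using assms by (auto simp: A'_def)
  have "set_family n (insert q P) c A'"
    using A(1) B u A' by (auto simp: set_family_def veronese_exponents_def exponents_def)
  moreover have "dominates (insert q P) m A'"
    unfolding dominates_def
  proof
    fix x
    have "card {p \<in> insert q P. x \<in> A' p} = (if x \<in> B then 1 else 0) + card {p \<in> P. x \<in> A p}"
      using card_filter_insert[OF assms(1,2), of "\<lambda>p. x \<in> A' p"] A' by (simp cong: conj_cong)
    moreover have "(if x \<in> B then 1 else 0) \<le> Poly_Mapping.lookup u x"
      using B by (auto simp: in_keys_iff subset_iff Suc_le_eq)
    moreover have "card {p \<in> P. x \<in> A p} \<le> Poly_Mapping.lookup v x"
      using A(2) by (simp add: dominates_def)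
    ultimately show "card {p \<in> insert q P. x \<in> A' p} \<le> Poly_Mapping.lookup m x"
      by (simp add: m lookup_add)
  qed
  moreover have "m \<in> exponents n"
    using u v by (auto simp: m dominating_def veronese_exponents_def intro: exponents_add)
  ultimately show "m \<in> ?R" by (auto simp: dominating_def)
next
  fix m assume "m \<in> ?R"
  then obtain A where m: "m \<in> exponents n" and A: "set_family n (insert q P) c A"
    "dominates (insert q P) m A" by (auto simp: dominating_def)
  \<comment> \<open>The indicator vector of \<open>A q\<close>, the exponent of the generator taken
    from the new factor.\<close>
  define u where "u = (\<Sum>x\<in>A q. Poly_Mapping.single x (1::nat))"
  define v where "v = m - u"
  have Aq: "A q \<subseteq> {1..n}" "card (A q) = n + 1 - c q" using A(1) by (auto simp: set_family_def)
  then have "finite (A q)" by (auto intro: finite_subset)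
  then have lu: "Poly_Mapping.lookup u x = (if x \<in> A q then 1 else 0)" for x
    by (simp add: u_def lookup_sum lookup_single when_def)
  then have ku: "Poly_Mapping.keys u = A q" by (auto simp: in_keys_iff split: if_splits)
  have le: "(if x \<in> A q then 1 else 0) + card {p \<in> P. x \<in> A p} \<le> Poly_Mapping.lookup m x" for x
    using A(2) card_filter_insert[OF assms(1,2), of "\<lambda>p. x \<in> A p"]
    unfolding dominates_def by metis
  have "Poly_Mapping.lookup u x \<le> Poly_Mapping.lookup m x" for x
    using le[of x] by (simp add: lu)
  then have "m = u + v"
    by (intro poly_mapping_eqI) (simp add: v_def lookup_add lookup_minus)
  moreover have "u \<in> veronese_exponents n (c q)"
    using Aq assms(3) by (auto simp: veronese_exponents_def exponents_def ku)
  moreover have "v \<in> dominating n P c"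
  proof -
    have "card {p \<in> P. x \<in> A p} \<le> Poly_Mapping.lookup v x" for x
      using le[of x] by (auto simp: v_def lookup_minus lu)
    moreover have "v \<in> exponents n" using m by (simp add: exponents_iff v_def lookup_minus)
    ultimately show ?thesis using A(1) by (auto simp: dominating_def dominates_def set_family_def)
  qed
  ultimately show "m \<in> ?L" by blast
qed

section \<open>From set families to products of ideals\<close>

lemma finprod_veronese:
  assumes "finite P" "c ` P \<subseteq> {1..n}"
  shows "(\<Otimes>\<^bsub>ideals_set (poly_ring n)\<^esub> p \<in> P. veronese n (c p)) =
    (mspan (dominating n P c) :: 'k::field mpoly set)"
proof -
  interpret cring "poly_ring n :: 'k mpoly ring" by (rule cring_poly_ring)
  interpret S: comm_monoid "ideals_set (poly_ring n :: 'k mpoly ring)"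
    by (rule ideals_set_is_comm_monoid)
  show ?thesis
    using assms
  proof (induction P rule: finite_induct)
    case empty
    \<comment> \<open>The empty product imposes no condition, which matches the unit
      \<open>R\<close> of the monoid of ideals.\<close>
    have "dominating n {} c = exponents n"
      by (auto simp: dominating_def set_family_def dominates_def)
    moreover have "\<one>\<^bsub>ideals_set (poly_ring n)\<^esub> = (mspan (exponents n) :: 'k mpoly set)"
      by (simp add: ideals_set_def poly_ring_def mspan_def)
    ultimately show ?case by (simp only: S.finprod_empty)
  next
    case (insert q P)
    have v: "(veronese n (c p) :: 'k mpoly set) \<in> carrier (ideals_set (poly_ring n))"
      if "p \<in> insert q P" for p
    proof -
      have "c p \<le> n" using insert.prems that by auto
      from ideal_veronese[OF this] show ?thesis by (simp add: ideals_set_def)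
    qed
    have "(\<Otimes>\<^bsub>ideals_set (poly_ring n)\<^esub> p \<in> insert q P. veronese n (c p) :: 'k mpoly set) =
        veronese n (c q) \<otimes>\<^bsub>ideals_set (poly_ring n)\<^esub> (\<Otimes>\<^bsub>ideals_set (poly_ring n)\<^esub> p \<in> P. veronese n (c p))"
      by (rule S.finprod_insert) (use insert.hyps v in blast)+
    also have "\<dots> = veronese n (c q) \<otimes>\<^bsub>ideals_set (poly_ring n)\<^esub> mspan (dominating n P c)"
      using insert.IH insert.prems by simp
    also have "\<dots> = ideal_prod (poly_ring n) (mspan (veronese_exponents n (c q))) (mspan (dominating n P c))"
      using insert.prems by (simp add: ideals_set_def veronese_eq_mspan)
    also have "\<dots> = mspan (dominating n (insert q P) c)"
      using insert.prems
      by (simp add: ideal_prod_mspan upset_veronese_exponents upset_dominating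
          dominating_insert[OF insert.hyps])
    finally show ?case .
  qed
qed

text \<open>The \<open>i\<close>-th power is spread over the copies \<open>(i, k)\<close> with
  \<open>k < e i\<close>, so that equal factors carry distinct indices. For \<open>e i = 0\<close>
  there is no copy, as the zeroth power requires.\<close>

lemma finprod_veronese_powers:
  "(\<Otimes>\<^bsub>ideals_set (poly_ring n)\<^esub> i \<in> {1..n}. veronese n i [^]\<^bsub>ideals_set (poly_ring n)\<^esub> (e i :: nat)) =
    (mspan (dominating n (SIGMA i:{1..n}. {..<e i}) fst) :: 'k::field mpoly set)"
proof -
  interpret cring "poly_ring n :: 'k mpoly ring" by (rule cring_poly_ring)
  interpret S: comm_monoid "ideals_set (poly_ring n :: 'k mpoly ring)"
    by (rule ideals_set_is_comm_monoid)
  have v: "(veronese n i :: 'k mpoly set) \<in> carrier (ideals_set (poly_ring n))"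
    if "i \<in> {1..n}" for i
    using that ideal_veronese[of i n] by (auto simp: ideals_set_def)
  have "(\<Otimes>\<^bsub>ideals_set (poly_ring n)\<^esub> i \<in> {1..n}. veronese n i [^]\<^bsub>ideals_set (poly_ring n)\<^esub> e i :: 'k mpoly set) =
    (\<Otimes>\<^bsub>ideals_set (poly_ring n)\<^esub> i \<in> {1..n}.
      \<Otimes>\<^bsub>ideals_set (poly_ring n)\<^esub> p \<in> {i} \<times> {..<e i}. veronese n (fst p))"
  proof (rule S.finprod_cong')
    fix i assume i: "i \<in> {1..n}"
    have "(\<Otimes>\<^bsub>ideals_set (poly_ring n)\<^esub> p \<in> {i} \<times> {..<e i}. veronese n (fst p)) =
        (\<Otimes>\<^bsub>ideals_set (poly_ring n)\<^esub> p \<in> {i} \<times> {..<e i}. veronese n i :: 'k mpoly set)"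
      by (rule S.finprod_cong') (use v[OF i] in auto)
    then show "veronese n i [^]\<^bsub>ideals_set (poly_ring n)\<^esub> e i =
        (\<Otimes>\<^bsub>ideals_set (poly_ring n)\<^esub> p \<in> {i} \<times> {..<e i}. veronese n (fst p) :: 'k mpoly set)"
      using S.finprod_const[OF v[OF i], of "{i} \<times> {..<e i}"] by (simp add: card_cartesian_product)
  qed (use v in \<open>auto intro!: S.finprod_closed simp del: atLeastAtMost_iff\<close>)
  also have "\<dots> = (\<Otimes>\<^bsub>ideals_set (poly_ring n)\<^esub> p \<in> (\<Union>i\<in>{1..n}. {i} \<times> {..<e i}). veronese n (fst p))"
    by (rule S.finprod_UN_disjoint[symmetric]) (use v in \<open>auto simp: pairwise_def disjnt_def\<close>)
  also have "(\<Union>i\<in>{1..n}. {i} \<times> {..<e i}) = (SIGMA i:{1..n}. {..<e i})" by auto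
  finally show ?thesis by (simp add: finprod_veronese image_subset_iff split_beta)
qed

section \<open>The product is symmetric strongly shifted\<close>

lemma lookup_map_key_inj:
  "inj f \<Longrightarrow> Poly_Mapping.lookup (Poly_Mapping.map_key f m) x = Poly_Mapping.lookup m (f x)"
  by (simp add: map_key.rep_eq)

text \<open>The new exponent at \<open>x\<close> is the old one at \<open>\<sigma> x\<close>. Taking
  preimages of the sets \<open>A p\<close> changes the counts in the same way and preserves
  sizes.\<close>

lemma map_key_dominating:
  assumes "\<sigma> permutes {1..n}" "m \<in> dominating n P c"
  shows "Poly_Mapping.map_key \<sigma> m \<in> dominating n P c"
proof -
  have b: "bij \<sigma>" and i: "inj \<sigma>" using assms(1) permutes_bij permutes_inj by blast+
  obtain A where m: "m \<in> exponents n" and A: "set_family n P c A" "dominates P m A"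
    using assms(2) by (auto simp: dominating_def)
  have "set_family n P c (\<lambda>p. \<sigma> -` A p)"
    unfolding set_family_def
  proof
    fix p assume "p \<in> P"
    then have Ap: "A p \<subseteq> {1..n}" "card (A p) = n + 1 - c p" using A by (auto simp: set_family_def)
    have "card (\<sigma> -` A p) = card (A p)"
      using i bij_is_surj[OF b] by (intro card_vimage_inj) auto
    moreover have "\<sigma> -` A p \<subseteq> {1..n}" using Ap permutes_in_image[OF assms(1)] by blast
    ultimately show "\<sigma> -` A p \<subseteq> {1..n} \<and> card (\<sigma> -` A p) = n + 1 - c p" using Ap by simp
  qed
  moreover have "dominates P (Poly_Mapping.map_key \<sigma> m) (\<lambda>p. \<sigma> -` A p)"
    using A by (simp add: dominates_def lookup_map_key_inj i)
  moreover have "Poly_Mapping.map_key \<sigma> m \<in> exponents n"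
    using m permutes_not_in[OF assms(1)] by (simp add: exponents_iff lookup_map_key_inj i)
  ultimately show ?thesis by (auto simp: dominating_def)
qed

text \<open>Exchanging \<open>j\<close> for \<open>i\<close> in \<open>A p\<close> changes the
  counts at \<open>i\<close> and \<open>j\<close> just as the shift changes \<open>m\<close>. Since
  \<open>A p\<close> contains \<open>j\<close>, the exponent there is positive and the subtraction
  is exact.\<close>

lemma dominating_move:
  assumes P: "finite P" and m: "m \<in> exponents n" and A: "set_family n P c A" "dominates P m A"
    and p: "p \<in> P" "j \<in> A p" "i \<notin> A p" and i: "i \<in> {1..n}"
  shows "m + Poly_Mapping.single i 1 - Poly_Mapping.single j 1 \<in> dominating n P c"
proof -
  define B where "B = A(p := insert i (A p - {j}))"
  have Ap: "A p \<subseteq> {1..n}" "card (A p) = n + 1 - c p" using A(1) p by (auto simp: set_family_def)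
  then have fin: "finite (A p)" by (auto intro: finite_subset)
  have "card (insert i (A p - {j})) = card (A p)"
    using p fin card_gt_0_iff[of "A p"] by (subst card_insert_disjoint) auto
  then have "set_family n P c B"
    using A(1) i Ap by (auto simp: set_family_def B_def)
  moreover have "dominates P (m + Poly_Mapping.single i 1 - Poly_Mapping.single j 1) B"
    unfolding dominates_def
  proof
    fix x
    \<comment> \<open>The index \<open>p\<close> is split off, being the only one at which
      \<open>A\<close> and \<open>B\<close> differ.\<close>
    have P': "P = insert p (P - {p})" using p by auto
    have c: "card {q \<in> P. Q q} = (if Q p then 1 else 0) + card {q \<in> P - {p}. Q q}" for Q
      using card_filter_insert[of "P - {p}" p Q] P unfolding P'[symmetric] by simp
    have e: "{q \<in> P - {p}. x \<in> B q} = {q \<in> P - {p}. x \<in> A q}" by (auto simp: B_def)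
    have "card {q \<in> P. x \<in> A q} \<le> Poly_Mapping.lookup m x" using A(2) by (simp add: dominates_def)
    then show "card {q \<in> P. x \<in> B q} \<le>
        Poly_Mapping.lookup (m + Poly_Mapping.single i 1 - Poly_Mapping.single j 1) x"
      unfolding c[of "\<lambda>q. x \<in> A q"] c[of "\<lambda>q. x \<in> B q"] e using p
      by (auto simp: B_def lookup_add lookup_minus lookup_single when_def split: if_splits)
  qed
  moreover have "m + Poly_Mapping.single i 1 - Poly_Mapping.single j 1 \<in> exponents n"
    using m i by (auto simp: exponents_iff lookup_add lookup_minus lookup_single when_def)
  ultimately show ?thesis by (auto simp: dominating_def)
qed

lemma dominating_shift:
  assumes P: "finite P" and m: "m \<in> dominating n P c" and i: "i \<in> {1..n}"
    and lt: "Poly_Mapping.lookup m i < Poly_Mapping.lookup m j"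
  shows "m + Poly_Mapping.single i 1 - Poly_Mapping.single j 1 \<in> dominating n P c"
proof -
  obtain A where me: "m \<in> exponents n" and A: "set_family n P c A" "dominates P m A"
    using m by (auto simp: dominating_def)
  have le: "card {p \<in> P. x \<in> A p} \<le> Poly_Mapping.lookup m x" for x
    using A(2) by (simp add: dominates_def)
  show ?thesis
  proof (cases "card {p \<in> P. j \<in> A p} < Poly_Mapping.lookup m j")
    case True
    \<comment> \<open>There is spare weight at \<open>j\<close>, so the same family tolerates the
      loss of one unit.\<close>
    have "dominates P (m + Poly_Mapping.single i 1 - Poly_Mapping.single j 1) A"
      unfolding dominates_def
    proof
      fix x
      show "card {p \<in> P. x \<in> A p} \<le>
          Poly_Mapping.lookup (m + Poly_Mapping.single i 1 - Poly_Mapping.single j 1) x"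
        using le[of x] True lt by (auto simp: lookup_add lookup_minus lookup_single when_def)
    qed
    moreover have "m + Poly_Mapping.single i 1 - Poly_Mapping.single j 1 \<in> exponents n"
      using me i by (auto simp: exponents_iff lookup_add lookup_minus lookup_single when_def)
    ultimately show ?thesis using A by (auto simp: dominating_def)
  next
    case False
    \<comment> \<open>All weight at \<open>j\<close> is used, so more sets contain \<open>j\<close>
      than \<open>i\<close>, and one of them omits \<open>i\<close>.\<close>
    then have "card {p \<in> P. i \<in> A p} < card {p \<in> P. j \<in> A p}"
      using lt le[of i] by linarith
    then have "\<not> {p \<in> P. j \<in> A p} \<subseteq> {p \<in> P. i \<in> A p}"
      using P card_mono[of "{p \<in> P. i \<in> A p}" "{p \<in> P. j \<in> A p}"] by auto
    then obtain p where "p \<in> P" "j \<in> A p" "i \<notin> A p" by auto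
    then show ?thesis using dominating_move[OF P me A] i by blast
  qed
qed

lemma sss_dominating:
  assumes "finite P"
  shows "sss_ideal n (mspan (dominating n P c) :: 'k::field mpoly set)"
proof -
  let ?D = "dominating n P c"
  have "monomial_ideal n (mspan ?D :: 'k mpoly set)"
    unfolding monomial_ideal_iff
    using ideal_mspan[OF upset_dominating] by (auto simp: mspan_def xpow_def)
  moreover have "sym_fixed n (mspan ?D :: 'k mpoly set)"
    unfolding sym_fixed_def
  proof (intro allI impI)
    \<comment> \<open>\<open>map_key\<close> reverses composition, hence the order of the factors in
      the premise.\<close>
    have inv: "Poly_Mapping.map_key \<tau> (Poly_Mapping.map_key \<sigma> m) = m"
      if "bij \<sigma>" "bij \<tau>" "\<sigma> \<circ> \<tau> = id" for \<sigma> \<tau> :: "nat \<Rightarrow> nat" and m :: "nat \<Rightarrow>\<^sub>0 nat"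
      using map_key_compose[of \<tau> \<sigma> m] that by (simp add: bij_is_inj id_def map_key_id)
    have perm: "perm_poly \<sigma> p \<in> mspan ?D"
      if s: "\<sigma> permutes {1..n}" and p: "p \<in> mspan ?D" for \<sigma> and p :: "'k mpoly"
      unfolding mspan_def
    proof (intro CollectI subsetI)
      fix m assume "m \<in> Poly_Mapping.keys (perm_poly \<sigma> p)"
      then have "Poly_Mapping.map_key \<sigma> m \<in> ?D"
        using p by (auto simp: mspan_def in_keys_iff lookup_perm_poly(1)[OF permutes_bij[OF s]])
      \<comment> \<open>The known exponent is \<open>map_key \<sigma> m\<close>; the inverse
        permutation brings it back to \<open>m\<close>.\<close>
      from map_key_dominating[OF permutes_inv[OF s] this] show "m \<in> ?D"
        using inv[OF permutes_bij[OF s] permutes_bij[OF permutes_inv[OF s]] permutes_inv_o(1)[OF s]]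
        by simp
    qed
    fix \<sigma> assume s: "\<sigma> permutes {1..n}"
    define \<tau> where "\<tau> = Hilbert_Choice.inv \<sigma>"
    have t: "\<tau> permutes {1..n}" using s by (simp add: \<tau>_def permutes_inv)
    have "perm_poly \<sigma> (perm_poly \<tau> p) = p" for p :: "'k mpoly"
      using inv[OF permutes_bij[OF s] permutes_bij[OF t]] permutes_inv_o(1)[OF s]
      by (intro poly_mapping_eqI)
        (simp add: lookup_perm_poly(1)[OF permutes_bij[OF s]] lookup_perm_poly(1)[OF permutes_bij[OF t]] \<tau>_def[symmetric])
    then show "perm_poly \<sigma> ` mspan ?D = (mspan ?D :: 'k mpoly set)"
      using perm[OF s] perm[OF t] by (metis image_eqI image_subsetI subsetI subset_antisym)
  qed
  ultimately show ?thesis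
    using dominating_shift[OF assms] by (auto simp: sss_ideal_def partitions_of_def)
qed

section \<open>Minimality\<close>

text \<open>\<open>perm_poly \<sigma>\<close> sends the left monomial to the right one and maps
  \<open>I\<close> onto itself; injectivity gives the converse direction.\<close>

lemma xpow_map_key:
  fixes I :: "'k::field mpoly set"
  assumes "sss_ideal n I" "\<sigma> permutes {1..n}"
  shows "xpow (Poly_Mapping.map_key \<sigma> m) \<in> I \<longleftrightarrow> xpow m \<in> I"
proof -
  have b: "bij \<sigma>" using assms(2) permutes_bij by blast
  have "perm_poly \<sigma> ` I = I" using assms by (simp add: sss_ideal_def sym_fixed_def)
  moreover have "perm_poly \<sigma> (xpow (Poly_Mapping.map_key \<sigma> m)) = (xpow m :: 'k mpoly)"
    using perm_poly_single[OF b] by (simp add: xpow_def)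
  ultimately show ?thesis using inj_image_mem_iff[OF inj_perm_poly[OF b]] by metis
qed

text \<open>The termination measure: the factor n - x falls with \<open>x\<close>, so moving weight
  to the right lowers the sum.\<close>

definition defect :: "nat \<Rightarrow> (nat \<Rightarrow>\<^sub>0 nat) \<Rightarrow> nat" where
  "defect n m = (\<Sum>x\<in>{1..n}. (n - x) * Poly_Mapping.lookup m x)"

text \<open>Moving \<open>d\<close> units from \<open>i\<close> to \<open>j\<close> saves (j - i) *
  d. Leaving \<open>d\<close> arbitrary covers both single exchanges and transpositions.\<close>

lemma defect_less:
  assumes "1 \<le> i" "i < j" "j \<le> n"
    and off: "\<And>x. x \<noteq> i \<Longrightarrow> x \<noteq> j \<Longrightarrow> Poly_Mapping.lookup m' x = Poly_Mapping.lookup m x"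
    and eq: "Poly_Mapping.lookup m' i + Poly_Mapping.lookup m' j =
      Poly_Mapping.lookup m i + Poly_Mapping.lookup m j"
    and lt: "Poly_Mapping.lookup m' i < Poly_Mapping.lookup m i"
  shows "defect n m' < defect n m"
proof -
  have split: "defect n u = (n - i) * Poly_Mapping.lookup u i + (n - j) * Poly_Mapping.lookup u j +
      (\<Sum>x\<in>{1..n} - {i} - {j}. (n - x) * Poly_Mapping.lookup u x)" for u
    unfolding defect_def using assms(1-3)
    by (subst sum.remove[of "{1..n}" i], simp, simp, subst sum.remove[of "{1..n} - {i}" j]) simp_all
  define a where "a = Poly_Mapping.lookup m' i"
  define b where "b = Poly_Mapping.lookup m j"
  obtain d where d: "Poly_Mapping.lookup m i = a + d" "d > 0"
    using less_imp_add_positive[OF lt] unfolding a_def by metis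
  have d': "Poly_Mapping.lookup m' j = b + d" using eq d by (simp add: a_def b_def)
  have "(n - j) * d < (n - i) * d" using assms(1-3) d by simp
  then have "(n - i) * a + (n - j) * (b + d) < (n - i) * (a + d) + (n - j) * b"
    by (simp add: algebra_simps)
  moreover have "(\<Sum>x\<in>{1..n} - {i} - {j}. (n - x) * Poly_Mapping.lookup m' x) =
      (\<Sum>x\<in>{1..n} - {i} - {j}. (n - x) * Poly_Mapping.lookup m x)"
    by (rule sum.cong) (auto simp: off)
  ultimately show ?thesis
    unfolding split d(1) d' by (simp add: a_def b_def)
qed

lemma defect_transpose:
  assumes "1 \<le> i" "i < j" "j \<le> n" "Poly_Mapping.lookup m j < Poly_Mapping.lookup m i"
  shows "defect n (Poly_Mapping.map_key (transpose i j) m) < defect n m"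
  using assms by (intro defect_less[of i j]) (auto simp: lookup_map_key_inj transpose_eq_iff)

text \<open>The defining condition concerns partitions only. An arbitrary exponent vector is sorted
  by transpositions of inverted pairs, each lowering the defect; they carry \<open>i\<close> and
  \<open>j\<close> along, so both vary in the induction.\<close>

lemma sss_ideal_shift:
  fixes I :: "'k::field mpoly set"
  assumes I: "sss_ideal n I"
  shows "xpow m \<in> I \<Longrightarrow> i \<in> {1..n} \<Longrightarrow> j \<in> {1..n} \<Longrightarrow>
    Poly_Mapping.lookup m i < Poly_Mapping.lookup m j \<Longrightarrow>
    xpow (m + Poly_Mapping.single i 1 - Poly_Mapping.single j 1) \<in> I"
proof (induction "defect n m" arbitrary: m i j rule: less_induct)
  case less
  interpret I: ideal I "poly_ring n" using I by (simp add: sss_ideal_def monomial_ideal_iff)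
  have m: "m \<in> exponents n" using I.Icarr[OF less.prems(1)] by (simp add: xpow_def)
  show ?case
  proof (cases "m \<in> partitions n")
    case True
    \<comment> \<open>The exponents of a partition increase weakly, so the strict inequality orders
      the positions.\<close>
    then have "i < j"
      using less.prems by (force simp: partitions_def not_less dest!: leI)
    then show ?thesis
      using I True less.prems by (auto simp: sss_ideal_def partitions_of_def)
  next
    case False
    then obtain p q where pq: "1 \<le> p" "p < q" "q \<le> n"
      and gt: "Poly_Mapping.lookup m q < Poly_Mapping.lookup m p"
      using m by (auto simp: partitions_def not_le) (metis le_neq_implies_less less_irrefl)
    define \<tau> where "\<tau> = transpose p q"
    have t: "\<tau> permutes {1..n}" unfolding \<tau>_def using pq by (intro permutes_swap_id) auto
    have i: "inj \<tau>" using t permutes_inj by blast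
    have tt: "\<tau> (\<tau> x) = x" for x by (simp add: \<tau>_def)
    let ?m = "Poly_Mapping.map_key \<tau> m"
    have "xpow (?m + Poly_Mapping.single (\<tau> i) 1 - Poly_Mapping.single (\<tau> j) 1) \<in> I"
    proof (rule less.hyps)
      show "defect n ?m < defect n m" unfolding \<tau>_def using defect_transpose[OF pq gt] .
      show "xpow ?m \<in> I" using less.prems(1) xpow_map_key[OF I t] by simp
      show "\<tau> i \<in> {1..n}" "\<tau> j \<in> {1..n}" using less.prems(2,3) permutes_in_image[OF t] by blast+
      show "Poly_Mapping.lookup ?m (\<tau> i) < Poly_Mapping.lookup ?m (\<tau> j)"
        using less.prems(4) by (simp add: lookup_map_key_inj i tt)
    qed
    \<comment> \<open>Shifting commutes with renaming the variables; \<open>\<tau>\<close> is its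
      own inverse.\<close>
    moreover have "?m + Poly_Mapping.single (\<tau> i) 1 - Poly_Mapping.single (\<tau> j) 1 =
        Poly_Mapping.map_key \<tau> (m + Poly_Mapping.single i 1 - Poly_Mapping.single j 1)"
    proof (rule poly_mapping_eqI)
      fix x
      have "\<tau> y = x \<longleftrightarrow> y = \<tau> x" for y using tt by metis
      then show "Poly_Mapping.lookup (?m + Poly_Mapping.single (\<tau> i) 1 - Poly_Mapping.single (\<tau> j) 1) x =
        Poly_Mapping.lookup (Poly_Mapping.map_key \<tau> (m + Poly_Mapping.single i 1 - Poly_Mapping.single j 1)) x"
        by (simp add: lookup_map_key_inj i lookup_add lookup_minus lookup_single when_def)
    qed
    ultimately show ?thesis using xpow_map_key[OF I t] by simp
  qed
qed

text \<open>By \<open>lc\<close>, \<open>l\<close> is the sum of the indicator vectors of the final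
  segments \<open>{c p..n}\<close>, so it is the vector at which the rightward process
  stops.\<close>

lemma xpow_dominating_mem:
  fixes I :: "'k::field mpoly set"
  assumes I: "sss_ideal n I" and l: "xpow l \<in> I" and P: "finite P" and c: "c ` P \<subseteq> {1..n}"
    and lc: "\<And>x. x \<in> {1..n} \<Longrightarrow> Poly_Mapping.lookup l x = card {p \<in> P. c p \<le> x}"
  shows "m \<in> dominating n P c \<Longrightarrow> xpow m \<in> I"
proof (induction "defect n m" arbitrary: m rule: less_induct)
  case less
  interpret I: ideal I "poly_ring n" using I by (simp add: sss_ideal_def monomial_ideal_iff)
  obtain A where m: "m \<in> exponents n" and A: "set_family n P c A" "dominates P m A"
    using less.prems by (auto simp: dominating_def)
  show ?case
  proof (cases "\<exists>p\<in>P. \<exists>i j. i < j \<and> j \<le> n \<and> i \<in> A p \<and> j \<notin> A p")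
    case True
    then obtain p i j where p: "p \<in> P" "i \<in> A p" "j \<notin> A p" and ij: "i < j" "j \<le> n" by blast
    have "A p \<subseteq> {1..n}" using A(1) p by (simp add: set_family_def)
    then have i1: "1 \<le> i" using p by auto
    have "p \<in> {p \<in> P. i \<in> A p}" using p by simp
    then have "card {p \<in> P. i \<in> A p} > 0" using P card_gt_0_iff by fastforce
    then have mi: "Poly_Mapping.lookup m i > 0"
      using A(2) by (auto simp: dominates_def intro: less_le_trans)
    show ?thesis
    proof (cases "Poly_Mapping.lookup m i \<le> Poly_Mapping.lookup m j")
      case True
      \<comment> \<open>One unit moves from \<open>i\<close> to \<open>j\<close>. The case
        assumption makes \<open>m'\<close> smaller at \<open>i\<close> than at \<open>j\<close>, so
        the ideal admits the shift back to \<open>m\<close>.\<close>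
      define m' where "m' = m + Poly_Mapping.single j 1 - Poly_Mapping.single i 1"
      have lm': "Poly_Mapping.lookup m' i = Poly_Mapping.lookup m i - 1"
        "Poly_Mapping.lookup m' j = Poly_Mapping.lookup m j + 1"
        "x \<noteq> i \<Longrightarrow> x \<noteq> j \<Longrightarrow> Poly_Mapping.lookup m' x = Poly_Mapping.lookup m x" for x
        using ij by (auto simp: m'_def lookup_add lookup_minus lookup_single when_def)
      have "m' \<in> dominating n P c"
        unfolding m'_def using dominating_move[OF P m A p] ij by simp
      moreover have "defect n m' < defect n m"
        using i1 ij mi by (intro defect_less[of i j]) (auto simp: lm')
      ultimately have "xpow m' \<in> I" using less.hyps by blast
      then have "xpow (m' + Poly_Mapping.single i 1 - Poly_Mapping.single j 1) \<in> I"
        using sss_ideal_shift[OF I, of m' i j] i1 ij mi True by (simp add: lm')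
      moreover have "m' + Poly_Mapping.single i 1 - Poly_Mapping.single j 1 = m"
        using mi ij
        by (intro poly_mapping_eqI) (auto simp: m'_def lookup_add lookup_minus lookup_single when_def)
      ultimately show ?thesis by simp
    next
      case False
      have t: "transpose i j permutes {1..n}" using i1 ij by (intro permutes_swap_id) auto
      have "xpow (Poly_Mapping.map_key (transpose i j) m) \<in> I"
        using less.hyps[OF defect_transpose[OF i1 ij]] False map_key_dominating[OF t less.prems]
        by simp
      then show ?thesis using xpow_map_key[OF I t] by simp
    qed
  next
    case False
    \<comment> \<open>If \<open>x \<ge> c p\<close> were missing, all n + 1 - c p elements of
      \<open>A p\<close> would lie above \<open>x\<close>, where there are only n - x
      places.\<close>
    have sub: "{c p..n} \<subseteq> A p" if p: "p \<in> P" for p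
    proof
      fix x assume x: "x \<in> {c p..n}"
      show "x \<in> A p"
      proof (rule ccontr)
        assume nx: "x \<notin> A p"
        have "A p \<subseteq> {Suc x..n}"
        proof
          fix y assume y: "y \<in> A p"
          then have "y \<le> n" using A(1) p by (force simp: set_family_def)
          moreover have "x < y"
            using False p y nx x by (metis atLeastAtMost_iff linorder_neqE_nat)
          ultimately show "y \<in> {Suc x..n}" by simp
        qed
        then have "card (A p) \<le> n - x" using card_mono[of "{Suc x..n}" "A p"] by simp
        then show False using A(1) p x by (auto simp: set_family_def)
      qed
    qed
    have le: "Poly_Mapping.lookup l x \<le> Poly_Mapping.lookup m x" for x
    proof (cases "x \<in> {1..n}")
      case True
      have "card {p \<in> P. c p \<le> x} \<le> card {p \<in> P. x \<in> A p}"
        using P True by (intro card_mono) (auto intro!: subsetD[OF sub])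
      also have "\<dots> \<le> Poly_Mapping.lookup m x" using A(2) by (simp add: dominates_def)
      finally show ?thesis using True by (simp add: lc)
    next
      case False
      moreover have "l \<in> exponents n" using I.Icarr[OF l] by (simp add: xpow_def)
      ultimately show ?thesis by (simp add: exponents_iff)
    qed
    have "m = (m - l) + l"
      by (rule poly_mapping_eqI) (simp add: lookup_add lookup_minus le)
    then have "xpow m = xpow (m - l) * (xpow l :: 'k mpoly)" by (metis xpow_add)
    moreover have "m - l \<in> exponents n" using m by (simp add: exponents_iff lookup_minus)
    ultimately show ?thesis using I.I_l_closed[OF l, of "xpow (m - l)"] by (simp add: xpow_def)
  qed
qed

section \<open>Identification of the two ideals\<close>

lemma Sss_eq_mspan_dominating:
  assumes l: "l \<in> partitions n" and P: "finite P" and c: "c ` P \<subseteq> {1..n}"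
    and lc: "\<And>x. x \<in> {1..n} \<Longrightarrow> Poly_Mapping.lookup l x = card {p \<in> P. c p \<le> x}"
  shows "(Sss n {l} :: 'k::field mpoly set) = mspan (dominating n P c)"
proof
  have L: "{l} \<subseteq> partitions n" using l by simp
  \<comment> \<open>Final segments witness that \<open>l\<close> itself is dominating: by
    \<open>lc\<close> the counts on \<open>{1..n}\<close> are its entries.\<close>
  have "set_family n P c (\<lambda>p. {c p..n})" using c by (auto simp: set_family_def)
  moreover have "card {p \<in> P. x \<in> {c p..n}} \<le> Poly_Mapping.lookup l x" for x
  proof (cases "x \<in> {1..n}")
    case False
    then have "{p \<in> P. x \<in> {c p..n}} = {}" using c by force
    then show ?thesis by (simp only: card.empty)
  qed (simp add: lc)
  ultimately have "l \<in> dominating n P c"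
    using l by (auto simp: dominating_def dominates_def partitions_def)
  then show "Sss n {l} \<subseteq> (mspan (dominating n P c) :: 'k mpoly set)"
    by (intro Sss_smallest(3)[OF L] sss_dominating P) simp
  have S: "sss_ideal n (Sss n {l} :: 'k mpoly set)" "xpow l \<in> (Sss n {l} :: 'k mpoly set)"
    using Sss_smallest(1,2)[OF L] by auto
  show "mspan (dominating n P c) \<subseteq> (Sss n {l} :: 'k mpoly set)"
    using S xpow_dominating_mem[OF S P c lc]
    by (intro mspan_subset_ideal) (auto simp: sss_ideal_def monomial_ideal_iff)
qed

theorem proposition3p15:
  fixes n :: nat and l :: "nat \<Rightarrow>\<^sub>0 nat"
  assumes "l \<in> partitions n"
  shows "(Sss n {l} :: 'k::field mpoly set) =
    (\<Otimes>\<^bsub>ideals_set (poly_ring n)\<^esub> i \<in> {1..n}.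
       veronese n i [^]\<^bsub>ideals_set (poly_ring n)\<^esub>
         (Poly_Mapping.lookup l i - Poly_Mapping.lookup l (i - 1)))"
proof -
  define e where "e i = Poly_Mapping.lookup l i - Poly_Mapping.lookup l (i - 1)" for i
  \<comment> \<open>One index for each Veronese factor, with \<open>e i\<close> copies of
    \<open>i\<close>.\<close>
  define P where "P = (SIGMA i:{1..n}. {..<e i})"
  have "Poly_Mapping.lookup l x = card {p \<in> P. fst p \<le> x}" if "x \<in> {1..n}" for x
  proof -
    have "{p \<in> P. fst p \<le> x} = (SIGMA i:{1..x}. {..<e i})" using that by (auto simp: P_def)
    \<comment> \<open>The sum telescopes from the value 0 at index 0; monotonicity makes the
      natural-number differences exact.\<close>
    moreover have "(\<Sum>i\<in>{1..y}. e i) = Poly_Mapping.lookup l y" if "y \<le> n" for y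
      using that
    proof (induction y)
      case 0
      then show ?case using partitions_lookup_0[OF assms] by simp
    next
      case (Suc y)
      have "Poly_Mapping.lookup l y \<le> Poly_Mapping.lookup l (Suc y)"
      \<comment> \<open>Monotonicity in \<open>partitions\<close> starts at index 1, so the step
        from 0 to 1 rests on the value 0 at index 0.\<close>
      proof (cases y)
        case 0
        then show ?thesis using partitions_lookup_0[OF assms] by simp
      next
        case (Suc z)
        then show ?thesis using assms \<open>Suc y \<le> n\<close> by (simp add: partitions_def)
      qed
      then show ?case using Suc by (simp add: e_def)
    qed
    ultimately show ?thesis using that by (simp add: card_SigmaI)
  qed
  then have "(Sss n {l} :: 'k mpoly set) = mspan (dominating n P fst)"
    by (intro Sss_eq_mspan_dominating assms) (auto simp: P_def)
  then show ?thesis unfolding finprod_veronese_powers by (simp only: P_def e_def)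
qed

end
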